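(* As formal power series in $q$, $$\sum_{n\geq 0}G_n(x_1,x_2;y_1,y_2)q^n=\frac{1+(y_2-x_2)q-\sqrt{1-2(x_2+y_2)q+((x_2+y_2)^2-4x_1y_1)q^2}}{2q},$$ where the square root is the power series with constant term $1$.
   Context: A plane tree is an unlabeled rooted tree in which the children of every vertex are linearly ordered from left to right; $\mathcal{P}_n$ is the set of plane trees with $n$ edges. A leaf is a vertex with no children, an interior vertex one with at least one child. A leaf is an old leaf if it is the leftmost child of its parent (this includes a leaf that is the only child of its parent), and a young leaf otherwise. For $T\in\mathcal P_n$, $\mathrm{oleaf}(T)$ and $\mathrm{yleaf}(T)$ are the numbers of old and young leaves, $\mathrm{oint}(T)$ is the number of interior vertices that are parents of old leaves, and $\mathrm{yint}(T)$ is the number of interior vertices that are not parents of old leaves. For $n\ge1$, $G_n(x_1,x_2;y_1,y_2)=\sum_{T\in\mathcal P_n}x_1^{\mathrm{oleaf}(T)}x_2^{\mathrm{yleaf}(T)}y_1^{\mathrm{oint}(T)}y_2^{\mathrm{yint}(T)}$, and $G_0(x_1,x_2;y_1,y_2)=y_2$. *)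

theory Defs
  imports "HOL-Computational_Algebra.Formal_Power_Series"
begin

datatype plane_tree = Node (subtrees: "plane_tree list")

text \<open>
  A vertex is represented by its address: the list of child indices met on the way from the
  root \<open>[]\<close> to it. The children of \<open>u\<close> are the vertices \<open>u @ [i]\<close>,
  with \<open>u @ [0]\<close> the leftmost one.
\<close>

primrec vertices :: "plane_tree \<Rightarrow> nat list set" where
  "vertices (Node ts) =
     insert [] (\<Union>(i, V) \<in> set (List.enumerate 0 (map vertices ts)). (#) i ` V)"

definition children :: "plane_tree \<Rightarrow> nat list \<Rightarrow> nat list set" where
  "children T u = {v \<in> vertices T. \<exists>i. v = u @ [i]}"

definition edges :: "plane_tree \<Rightarrow> (nat list \<times> nat list) set" where
  "edges T = {(u, v). u \<in> vertices T \<and> v \<in> children T u}"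

definition plane_trees :: "nat \<Rightarrow> plane_tree set" where
  "plane_trees n = {T. card (edges T) = n}"

definition leaves :: "plane_tree \<Rightarrow> nat list set" where
  "leaves T = {v \<in> vertices T. children T v = {}}"

definition interior_vertices :: "plane_tree \<Rightarrow> nat list set" where
  "interior_vertices T = {v \<in> vertices T. children T v \<noteq> {}}"

definition old_leaves :: "plane_tree \<Rightarrow> nat list set" where
  "old_leaves T = {v \<in> leaves T. \<exists>u. v = u @ [0]}"

definition young_leaves :: "plane_tree \<Rightarrow> nat list set" where
  "young_leaves T = leaves T - old_leaves T"

definition old_interior :: "plane_tree \<Rightarrow> nat list set" where
  "old_interior T = {u \<in> interior_vertices T. \<exists>v \<in> old_leaves T. v \<in> children T u}"

definition young_interior :: "plane_tree \<Rightarrow> nat list set" where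
  "young_interior T = interior_vertices T - old_interior T"

definition oleaf :: "plane_tree \<Rightarrow> nat" where "oleaf T = card (old_leaves T)"
definition yleaf :: "plane_tree \<Rightarrow> nat" where "yleaf T = card (young_leaves T)"
definition oint :: "plane_tree \<Rightarrow> nat" where "oint T = card (old_interior T)"
definition yint :: "plane_tree \<Rightarrow> nat" where "yint T = card (young_interior T)"

text \<open>
  The value at \<open>n = 0\<close> is a convention: the leaf/interior statistics of the one-vertex tree
  would give \<open>x2\<close> instead.
\<close>

definition G :: "nat \<Rightarrow> 'a \<Rightarrow> 'a \<Rightarrow> 'a \<Rightarrow> 'a \<Rightarrow> 'a::comm_semiring_1" where
  "G n x1 x2 y1 y2 =
     (if n = 0 then y2
      else \<Sum>T \<in> plane_trees n. x1 ^ oleaf T * x2 ^ yleaf T * y1 ^ oint T * y2 ^ yint T)"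

text \<open>
  The square root with constant term 1 of a power series with constant term 1: the function
  passed to \<^const>\<open>fps_radical\<close> chooses the constant term of the root. The lemmas
  below characterise it.
\<close>

definition fps_sqrt :: "'a::field_char_0 fps \<Rightarrow> 'a fps" where
  "fps_sqrt f = fps_radical (\<lambda>_ _. 1) 2 f"

lemma fps_sqrt_nth_0: "fps_nth (fps_sqrt f) 0 = 1"
  by (simp add: fps_sqrt_def)

lemma fps_sqrt_power2:
  assumes "fps_nth f 0 = 1"
  shows "fps_sqrt f ^ 2 = f"
  using power_radical[of f "\<lambda>_ _. 1" 1] assms
  by (simp add: fps_sqrt_def numeral_2_eq_2)

lemma fps_sqrt_unique:
  assumes "s ^ 2 = f" and "fps_nth s 0 = 1"
  shows "s = fps_sqrt f"
proof -
  have "fps_nth f 0 = 1" using assms by (auto simp: power2_eq_square)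
  then show ?thesis
    using radical_unique[of "\<lambda>_ _. 1" 1 f s] assms
    by (simp add: fps_sqrt_def numeral_2_eq_2)
qed

text \<open>Sanity check: the sum defining \<^const>\<open>G\<close> is over a finite set.\<close>

lemma vertices_Node:
  "vertices (Node ts) = insert [] (\<Union>i<length ts. (#) i ` vertices (ts ! i))"
  by (force simp: in_set_enumerate_eq)

lemma finite_vertices: "finite (vertices T)"
  by (induction T) (auto simp: in_set_enumerate_eq)

lemma prefix_vertex: "u @ [i] \<in> vertices T \<Longrightarrow> u \<in> vertices T"
proof (induction u arbitrary: T)
  case Nil
  show ?case by (cases T) simp
next
  case (Cons j u)
  then show ?case by (cases T) (auto simp: vertices_Node simp del: vertices.simps)
qed

lemma card_vertices: "card (vertices T) = Suc (card (edges T))"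
proof -
  have root: "[] \<in> vertices T" by (cases T) simp
  have "snd ` edges T = vertices T - {[]}"
  proof (intro equalityI subsetI)
    fix v assume v: "v \<in> vertices T - {[]}"
    then obtain u i where "v = u @ [i]" by (cases v rule: rev_cases) auto
    with v have "(u, v) \<in> edges T"
      using prefix_vertex[of u i T] by (auto simp: edges_def children_def)
    then show "v \<in> snd ` edges T" by force
  qed (auto simp: edges_def children_def)
  moreover have "inj_on snd (edges T)"
    by (auto simp: inj_on_def edges_def children_def)
  ultimately have "card (edges T) = card (vertices T - {[]})"
    by (metis card_image)
  then show ?thesis
    using root finite_vertices[of T] by (metis card.remove)
qed

lemma finite_card_vertices_le: "finite {T. card (vertices T) \<le> n}"
proof (induction n)
  case 0
  show ?case by (simp add: card_vertices)
next
  case (Suc n)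
  let ?A = "{T. card (vertices T) \<le> n}"
  have "{T. card (vertices T) \<le> Suc n}
          \<subseteq> Node ` {ts. set ts \<subseteq> ?A \<and> length ts \<le> n}"
  proof
    fix T assume "T \<in> {T. card (vertices T) \<le> Suc n}"
    then obtain ts where T: "T = Node ts" and le: "card (vertices (Node ts)) \<le> Suc n"
      by (cases T) auto
    have le': "card W \<le> n" if "W \<subseteq> vertices (Node ts) - {[]}" for W
    proof -
      have "card W \<le> card (vertices (Node ts) - {[]})"
        using that finite_vertices by (intro card_mono) (simp_all del: vertices.simps)
      also have "\<dots> = card (vertices (Node ts)) - 1"
        by (rule card_Diff_singleton) simp
      finally show ?thesis using le by simp
    qed
    have "card (vertices (ts ! i)) \<le> n" if "i < length ts" for i
      using le'[of "(#) i ` vertices (ts ! i)"] that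
      by (auto simp: card_image vertices_Node simp del: vertices.simps)
    moreover have "length ts \<le> n"
    proof -
      have root: "[] \<in> vertices S" for S by (cases S) simp
      have "(\<lambda>i. [i]) ` {..<length ts} \<subseteq> vertices (Node ts) - {[]}"
        using root by (subst vertices_Node) auto
      from le'[OF this] show ?thesis by (simp add: card_image inj_on_def)
    qed
    ultimately show "T \<in> Node ` {ts. set ts \<subseteq> ?A \<and> length ts \<le> n}"
      unfolding T by (intro imageI CollectI conjI subsetI) (auto simp: in_set_conv_nth)
  qed
  moreover have "finite {ts. set ts \<subseteq> ?A \<and> length ts \<le> n}"
    using Suc.IH by (rule finite_lists_length_le)
  ultimately show ?case by (meson finite_imageI finite_subset)
qed

lemma finite_plane_trees: "finite (plane_trees n)"
  by (rule finite_subset[OF _ finite_card_vertices_le[of "Suc n"]])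
    (auto simp: plane_trees_def card_vertices)

end

theory Submission
  imports Defs
begin

text \<open>
  Let \<open>A\<close> be the generating function of all plane trees in which the one-vertex tree has weight
  \<open>x\<^sub>2\<close>, so that \<open>A - x\<^sub>2\<close> is the sum over \<open>n \<ge> 1\<close> of \<open>G\<^sub>n q\<^sup>n\<close>. Passing to a subtree
  preserves the type of every vertex, except that a leaf becomes old when it is attached as a
  leftmost child. Hence a tree with at least one edge consists of a leftmost subtree, which
  together with the root contributes \<open>x\<^sub>1 y\<^sub>1\<close> if it is a single vertex and \<open>y\<^sub>2\<close> times
  its own weight otherwise, and of an arbitrary sequence of further subtrees:
  \[ A - x_2 = q \, \frac{x_1 y_1 + y_2 (A - x_2)}{1 - q A}. \]
  This is a quadratic equation for \<open>A\<close>.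
\<close>

text \<open>Addresses in different subtrees differ in their first index, so the union is disjoint.
  The locale gives both the sum, used to count vertices, and the product, used for weights.\<close>

lemma (in comm_monoid_set) vertices_Node:
  "F g (vertices (Node ts)) =
     f (g []) (F (\<lambda>i. F (\<lambda>u. g (i # u)) (vertices (ts ! i))) {..<length ts})"
proof -
  have "F g (\<Union>i<length ts. (#) i ` vertices (ts ! i)) =
          F (\<lambda>i. F g ((#) i ` vertices (ts ! i))) {..<length ts}"
    by (rule UNION_disjoint) (auto simp: finite_vertices)
  also have "\<dots> = F (\<lambda>i. F (\<lambda>u. g (i # u)) (vertices (ts ! i))) {..<length ts}"
    by (rule cong) (simp_all add: reindex o_def)
  finally show ?thesis
    unfolding Defs.vertices_Node by (subst insert) (auto simp: finite_vertices)
qed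

lemma card_edges_Nil: "card (edges (Node [])) = 0"
  using card_vertices[of "Node []"] by simp

lemma card_edges_Cons:
  "card (edges (Node (t # ts))) = Suc (card (edges t) + card (edges (Node ts)))"
proof -
  have "card (vertices (Node us)) = Suc (\<Sum>i<length us. card (vertices (us ! i)))" for us
    using sum.vertices_Node[of "\<lambda>_. 1 :: nat" us] by (simp del: vertices.simps)
  from this[of "t # ts"] this[of ts] show ?thesis
    by (simp add: card_vertices sum.lessThan_Suc_shift
        del: vertices.simps sum.lessThan_Suc)
qed

lemma root_in_vertices: "[] \<in> vertices T"
  by (cases T) simp

lemma Cons_in_vertices_iff:
  "i # u \<in> vertices (Node ts) \<longleftrightarrow> i < length ts \<and> u \<in> vertices (ts ! i)"
  by (auto simp: Defs.vertices_Node simp del: vertices.simps)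

lemma in_leaves_iff: "v \<in> leaves T \<longleftrightarrow> v \<in> vertices T \<and> (\<forall>i. v @ [i] \<notin> vertices T)"
  by (auto simp: leaves_def children_def)

lemma Nil_in_leaves_iff: "[] \<in> leaves T \<longleftrightarrow> T = Node []"
proof (cases T)
  case (Node ts)
  then show ?thesis
    by (cases ts)
      (auto simp: in_leaves_iff root_in_vertices Cons_in_vertices_iff simp del: vertices.simps)
qed

lemma Cons_in_leaves_iff:
  "i # u \<in> leaves (Node ts) \<longleftrightarrow> i < length ts \<and> u \<in> leaves (ts ! i)"
  by (auto simp: in_leaves_iff Cons_in_vertices_iff simp del: vertices.simps)

text \<open>An old leaf has last index 0, so \<open>u @ [0]\<close> is the only child of
  \<open>u\<close> that can be one.\<close>

lemma in_old_interior_iff: "u \<in> old_interior T \<longleftrightarrow> u @ [0] \<in> leaves T"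
proof
  assume "u @ [0] \<in> leaves T"
  then have "u @ [0] \<in> old_leaves T" and "u @ [0] \<in> children T u" and "u \<in> vertices T"
    using prefix_vertex[of u 0 T] by (auto simp: old_leaves_def leaves_def children_def)
  then show "u \<in> old_interior T"
    by (auto simp: old_interior_def interior_vertices_def)
qed (auto simp: old_interior_def old_leaves_def children_def)

text \<open>Localizes the four statistics, so that recursion can be checked vertex by vertex. The
  root \<open>[]\<close> does not end in 0, hence a root that is a leaf gets
  \<open>x2\<close>.\<close>

definition vertex_weight ::
  "'a \<Rightarrow> 'a \<Rightarrow> 'a \<Rightarrow> 'a \<Rightarrow> plane_tree \<Rightarrow> nat list \<Rightarrow> 'a" where
  "vertex_weight x1 x2 y1 y2 T v =
     (if v \<in> leaves T then (if \<exists>u. v = u @ [0] then x1 else x2)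
      else if v @ [0] \<in> leaves T then y1 else y2)"

definition tree_weight ::
  "'a \<Rightarrow> 'a \<Rightarrow> 'a \<Rightarrow> 'a \<Rightarrow> plane_tree \<Rightarrow> 'a::comm_semiring_1" where
  "tree_weight x1 x2 y1 y2 T = x1 ^ oleaf T * x2 ^ yleaf T * y1 ^ oint T * y2 ^ yint T"

text \<open>The vertices split into four classes, and the vertex weight is constant on each.\<close>

lemma tree_weight_eq_prod:
  "tree_weight x1 x2 y1 y2 T = (\<Prod>v\<in>vertices T. vertex_weight x1 x2 y1 y2 T v)"
proof -
  let ?c = "vertex_weight x1 x2 y1 y2 T"
  have interior: "interior_vertices T = vertices T - leaves T"
    by (auto simp: interior_vertices_def leaves_def)
  have leaves: "leaves T \<subseteq> vertices T" "old_leaves T \<subseteq> leaves T"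
    by (auto simp: leaves_def old_leaves_def)
  then have fin: "finite (leaves T)" "finite (interior_vertices T)"
    using finite_vertices[of T] by (auto simp: interior intro: finite_subset)
  have "prod ?c (vertices T) = prod ?c (interior_vertices T) * prod ?c (leaves T)"
    unfolding interior using leaves finite_vertices by (intro prod.subset_diff)
  moreover have "prod ?c (leaves T) = prod ?c (young_leaves T) * prod ?c (old_leaves T)"
    unfolding young_leaves_def using leaves fin by (intro prod.subset_diff)
  moreover have "prod ?c (interior_vertices T) =
      prod ?c (young_interior T) * prod ?c (old_interior T)"
    unfolding young_interior_def using fin
    by (intro prod.subset_diff) (auto simp: old_interior_def)
  moreover have "prod ?c (old_leaves T) = x1 ^ oleaf T"
    unfolding oleaf_def by (simp add: vertex_weight_def old_leaves_def)
  moreover have "prod ?c (young_leaves T) = x2 ^ yleaf T"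
    unfolding yleaf_def
    by (subst prod.cong[OF refl, of _ _ "\<lambda>_. x2"])
      (auto simp: vertex_weight_def young_leaves_def old_leaves_def)
  moreover have "prod ?c (old_interior T) = y1 ^ oint T"
    unfolding oint_def
    by (subst prod.cong[OF refl, of _ _ "\<lambda>_. y1"])
      (auto simp: vertex_weight_def in_old_interior_iff,
       auto simp: leaves_def children_def)
  moreover have "prod ?c (young_interior T) = y2 ^ yint T"
    unfolding yint_def
    by (subst prod.cong[OF refl, of _ _ "\<lambda>_. y2"])
      (auto simp: vertex_weight_def young_interior_def in_old_interior_iff
        interior_vertices_def leaves_def)
  ultimately show ?thesis
    by (simp add: tree_weight_def mult_ac)
qed

text \<open>Prepending \<open>i\<close> preserves being a leaf and changes the last index of an
  address only for \<open>u = []\<close>. Thus only a single vertex attached at index 0 changes its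
  type.\<close>

lemma vertex_weight_Cons:
  assumes "i < length ts" and "u \<noteq> [] \<or> i \<noteq> 0 \<or> ts ! i \<noteq> Node []"
  shows "vertex_weight x1 x2 y1 y2 (Node ts) (i # u) = vertex_weight x1 x2 y1 y2 (ts ! i) u"
  using assms
  by (cases u rule: rev_cases)
    (auto simp: vertex_weight_def Cons_in_leaves_iff Nil_in_leaves_iff Cons_eq_append_conv)

lemma tree_weight_Nil: "tree_weight x1 x2 y1 y2 (Node []) = x2"
  by (simp add: tree_weight_eq_prod vertex_weight_def Nil_in_leaves_iff)

lemma tree_weight_Cons:
  "tree_weight x1 x2 y1 y2 (Node (t # ts)) =
     (if t = Node [] then x1 * y1 else y2 * tree_weight x1 x2 y1 y2 t) *
     prod_list (map (tree_weight x1 x2 y1 y2) ts)"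
proof -
  let ?c = "vertex_weight x1 x2 y1 y2" and ?W = "tree_weight x1 x2 y1 y2"
  have rest: "(\<Prod>u\<in>vertices (ts ! i). ?c (Node (t # ts)) (Suc i # u)) = ?W (ts ! i)"
    if "i < length ts" for i
    unfolding tree_weight_eq_prod
    using that by (intro prod.cong refl) (simp add: vertex_weight_Cons)
  have first: "(\<Prod>u\<in>vertices t. ?c (Node (t # ts)) (0 # u)) = (if t = Node [] then x1 else ?W t)"
  proof (cases "t = Node []")
    case True
    then show ?thesis
      by (auto simp: vertex_weight_def Cons_in_leaves_iff Nil_in_leaves_iff)
  next
    case False
    then show ?thesis
      unfolding tree_weight_eq_prod by (auto intro!: prod.cong simp: vertex_weight_Cons)
  qed
  have root: "?c (Node (t # ts)) [] = (if t = Node [] then y1 else y2)"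
    by (simp add: vertex_weight_def Cons_in_leaves_iff Nil_in_leaves_iff)
  have "?W (Node (t # ts)) =
      ?c (Node (t # ts)) [] * ((\<Prod>u\<in>vertices t. ?c (Node (t # ts)) (0 # u)) *
      (\<Prod>i<length ts. \<Prod>u\<in>vertices (ts ! i). ?c (Node (t # ts)) (Suc i # u)))"
    unfolding tree_weight_eq_prod prod.vertices_Node
    by (simp add: prod.lessThan_Suc_shift del: vertices.simps prod.lessThan_Suc)
  also have "(\<Prod>i<length ts. \<Prod>u\<in>vertices (ts ! i). ?c (Node (t # ts)) (Suc i # u)) =
      prod_list (map ?W ts)"
    by (simp add: rest prod.list_conv_set_nth atLeast0LessThan)
  finally show ?thesis
    by (simp add: root first mult_ac)
qed

definition tree_gf :: "(plane_tree \<Rightarrow> 'a) \<Rightarrow> 'a::comm_semiring_1 fps" where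
  "tree_gf w = Abs_fps (\<lambda>n. \<Sum>T\<in>plane_trees n. w T)"

lemma plane_trees_0: "plane_trees 0 = {Node []}"
proof -
  have "card (edges T) = 0 \<longleftrightarrow> T = Node []" for T
  proof (cases T)
    case (Node ts)
    then show ?thesis
      by (cases ts) (simp_all add: card_edges_Nil card_edges_Cons)
  qed
  then show ?thesis
    by (auto simp: plane_trees_def)
qed

text \<open>Deleting the edge from the root to its leftmost child is a bijection onto pairs
  \<open>(t, s)\<close> with \<open>n\<close> edges in total; \<open>s\<close> keeps the root and
  the other subtrees.\<close>

lemma sum_plane_trees_Suc:
  "(\<Sum>T\<in>plane_trees (Suc n). w T) =
     (\<Sum>i\<le>n. \<Sum>t\<in>plane_trees i. \<Sum>s\<in>plane_trees (n - i). w (Node (t # subtrees s)))"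
proof -
  let ?P = "SIGMA i:{..n}. plane_trees i \<times> plane_trees (n - i)"
  have "(\<Sum>i\<le>n. \<Sum>t\<in>plane_trees i. \<Sum>s\<in>plane_trees (n - i). w (Node (t # subtrees s))) =
      (\<Sum>(i, t, s)\<in>?P. w (Node (t # subtrees s)))"
    by (simp add: sum.cartesian_product sum.Sigma finite_plane_trees)
  also have "\<dots> = (\<Sum>T\<in>plane_trees (Suc n). w T)"
  proof (rule sum.reindex_bij_witness[where
        i = "\<lambda>T. (card (edges (hd (subtrees T))), hd (subtrees T), Node (tl (subtrees T)))" and
        j = "\<lambda>(i, t, s). Node (t # subtrees s)"])
    fix T assume T: "T \<in> plane_trees (Suc n)"
    then obtain t ts where "T = Node (t # ts)"
      by (cases T; cases "subtrees T") (auto simp: plane_trees_def card_edges_Nil)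
    then show "(card (edges (hd (subtrees T))), hd (subtrees T), Node (tl (subtrees T))) \<in> ?P"
      and "(case (card (edges (hd (subtrees T))), hd (subtrees T), Node (tl (subtrees T))) of
             (i, t, s) \<Rightarrow> Node (t # subtrees s)) = T"
      using T by (auto simp: plane_trees_def card_edges_Cons)
  qed (auto simp: plane_trees_def card_edges_Cons)
  finally show ?thesis ..
qed

text \<open>The sum over the edge count of the leftmost subtree is a Cauchy product, and
  \<open>fps_X\<close> marks the deleted edge.\<close>

lemma tree_gf_split:
  assumes "\<And>t ts. w (Node (t # ts)) = g t * h (Node ts)"
  shows "tree_gf w = fps_const (w (Node [])) + fps_X * (tree_gf g * tree_gf h)"
proof (rule fps_ext)
  fix n
  show "fps_nth (tree_gf w) n =
      fps_nth (fps_const (w (Node [])) + fps_X * (tree_gf g * tree_gf h)) n"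
  proof (cases n)
    case 0
    then show ?thesis by (simp add: tree_gf_def plane_trees_0)
  next
    case (Suc m)
    then show ?thesis
      by (simp add: tree_gf_def sum_plane_trees_Suc assms)
        (simp add: fps_mult_nth sum_product atLeast0AtMost)
  qed
qed

lemma tree_gf_tree_weight:
  fixes x1 x2 y1 y2 :: "'a::comm_ring_1"
  defines "A \<equiv> tree_gf (tree_weight x1 x2 y1 y2)"
  shows "(A - fps_const x2) * (1 - fps_X * A) =
           fps_X * (fps_const (x1 * y1) + fps_const y2 * (A - fps_const x2))"
proof -
  let ?W = "tree_weight x1 x2 y1 y2"
  \<comment> \<open>\<open>P\<close> counts sequences of subtrees, each with the edge joining it to
    the root; it plays the role of \<open>1 / (1 - fps_X * A)\<close>.\<close>
  define P where "P = tree_gf (\<lambda>T. prod_list (map ?W (subtrees T)))"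
  define B where "B = tree_gf (\<lambda>t. if t = Node [] then x1 * y1 else y2 * ?W t)"
  have P: "P = 1 + fps_X * (A * P)"
    using tree_gf_split[of "\<lambda>T. prod_list (map ?W (subtrees T))" ?W
        "\<lambda>T. prod_list (map ?W (subtrees T))"]
    by (simp add: P_def A_def)
  have A: "A = fps_const x2 + fps_X * (B * P)"
    using tree_gf_split[of ?W "\<lambda>t. if t = Node [] then x1 * y1 else y2 * ?W t"
        "\<lambda>T. prod_list (map ?W (subtrees T))"]
    by (simp add: A_def B_def P_def tree_weight_Cons tree_weight_Nil)
  have "Node [] \<notin> plane_trees n" if "n \<noteq> 0" for n
    using that by (simp add: plane_trees_def card_edges_Nil)
  \<comment> \<open>The case distinction in \<open>B\<close> concerns only the single vertex, hence
    only coefficient 0, where \<open>A - fps_const x2\<close> vanishes.\<close>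
  then have B: "B = fps_const (x1 * y1) + fps_const y2 * (A - fps_const x2)"
    by (intro fps_ext)
      (auto simp: B_def A_def tree_gf_def plane_trees_0 tree_weight_Nil sum_distrib_left
        intro!: sum.cong)
  have "(A - fps_const x2) * (1 - fps_X * A) = fps_X * B * (P - fps_X * (A * P))"
    by (subst (1) A) (simp add: algebra_simps)
  also have "P - fps_X * (A * P) = 1"
    by (subst (1) P) simp
  finally show ?thesis
    by (simp add: B)
qed

text \<open>Only coefficient 0 differs: the convention for \<open>G\<close> puts \<open>y2\<close>
  where the single vertex has weight \<open>x2\<close>.\<close>

lemma Abs_fps_G:
  fixes x1 x2 y1 y2 :: "'a::comm_ring_1"
  shows "Abs_fps (\<lambda>n. G n x1 x2 y1 y2) =
           tree_gf (tree_weight x1 x2 y1 y2) + fps_const (y2 - x2)"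
  by (rule fps_ext)
    (simp add: G_def tree_gf_def plane_trees_0 tree_weight_Nil, simp add: tree_weight_def)

theorem theorem1p11:
  fixes x1 x2 y1 y2 :: "'a::field_char_0"
  shows "Abs_fps (\<lambda>n. G n x1 x2 y1 y2) =
    (1 + fps_const (y2 - x2) * fps_X
       - fps_sqrt (1 - 2 * fps_const (x2 + y2) * fps_X
                     + fps_const ((x2 + y2)\<^sup>2 - 4 * x1 * y1) * fps_X\<^sup>2))
    / (2 * fps_X)"
proof -
  define F where "F = Abs_fps (\<lambda>n. G n x1 x2 y1 y2)"
  define A where "A = tree_gf (tree_weight x1 x2 y1 y2)"
  \<comment> \<open>The value that the square root must have if the claimed formula is solved for
    it.\<close>
  define S where "S = 1 + fps_const (y2 - x2) * fps_X - 2 * fps_X * F"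
  define D where "D = 1 - 2 * fps_const (x2 + y2) * fps_X
      + fps_const ((x2 + y2)\<^sup>2 - 4 * x1 * y1) * fps_X\<^sup>2"
  define a b c d :: "'a fps" where abcd:
    "a = fps_const x1" "b = fps_const x2" "c = fps_const y1" "d = fps_const y2"
  have const_eqs: "fps_const (y2 - x2) = d - b" "fps_const (x2 + y2) = b + d"
      "fps_const ((x2 + y2)\<^sup>2 - 4 * x1 * y1) = (b + d)\<^sup>2 - 4 * a * c"
    unfolding abcd by (simp_all add: numeral_fps_const power2_eq_square)
  have "(A - b) * (1 - fps_X * A) = fps_X * (a * c + d * (A - b))"
    unfolding A_def abcd using tree_gf_tree_weight[of x1 x2 y1 y2] by simp
  moreover have F: "F = A + (d - b)"
    unfolding F_def A_def Abs_fps_G const_eqs ..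
  \<comment> \<open>Completing the square: \<open>S\<^sup>2 - D\<close> is
    \<open>- 4 * fps_X\<close> times the difference of the two sides of the quadratic equation for
    \<open>A\<close>.\<close>
  ultimately have "S\<^sup>2 = D"
    unfolding S_def D_def const_eqs by algebra
  \<comment> \<open>This selects the root \<open>S\<close> rather than \<open>- S\<close>.\<close>
  moreover have "fps_nth S 0 = 1"
    by (simp add: S_def mult.assoc numeral_fps_const)
  ultimately have "fps_sqrt D = S"
    by (metis fps_sqrt_unique)
  \<comment> \<open>The numerator is an explicit multiple of the nonzero series
    \<open>2 * fps_X\<close>, so the division is exact although \<open>fps_X\<close> is not a
    unit.\<close>
  then have "1 + fps_const (y2 - x2) * fps_X - fps_sqrt D = (2 * fps_X) * F"
    by (simp add: S_def)
  then show ?thesis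
    unfolding D_def F_def by simp
qed

end
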